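(* Let $n\ge2$ and let $Q=[q_{ij}]\in\mathbb{R}^{n\times n}$ be an orthogonal matrix ($QQ^T=I$) such that $q_{ij}\neq0$ if and only if $j\le i+1$ (i.e. $Q$ has the zero-nonzero pattern of a lower Hessenberg matrix with all entries on and below the superdiagonal nonzero). Then every super pattern of $\operatorname{sgn}(Q)$ allows orthogonality.
   Context: A sign pattern is a $(0,1,-1)$-matrix; $\operatorname{sgn}(A)$ is the entrywise sign of $A$. An $n\times n$ sign pattern $S$ allows orthogonality if there is a real orthogonal matrix $Q$ with $\operatorname{sgn}(Q)=S$. For sign patterns $S=[s_{ij}]$, $R=[r_{ij}]$ of the same size, $S_{\vec R}$ is the sign pattern with $(i,j)$-entry $s_{ij}$ if $s_{ij}\ne0$ and $r_{ij}$ otherwise; a super pattern of $S$ is any sign pattern of the form $S_{\vec R}$. *)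

theory Defs
  imports "Jordan_Normal_Form.Matrix"
begin

definition sign_pattern :: "real mat \<Rightarrow> bool" where
  "sign_pattern S \<longleftrightarrow> elements_mat S \<subseteq> {0, 1, -1}"

definition sgn_mat :: "real mat \<Rightarrow> real mat" where
  "sgn_mat A = map_mat sgn A"

text \<open>The predicate \<open>orthogonal_mat\<close> of \<open>Matrix\<close> only asks for nonzero, pairwise orthogonal
  columns, without normalization.\<close>
definition orthonormal_mat :: "real mat \<Rightarrow> bool" where
  "orthonormal_mat Q \<longleftrightarrow> square_mat Q \<and> Q * transpose_mat Q = 1\<^sub>m (dim_row Q)"

definition allows_orthogonality :: "real mat \<Rightarrow> bool" where
  "allows_orthogonality S \<longleftrightarrow> (\<exists>Q. orthonormal_mat Q \<and> sgn_mat Q = S)"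

text \<open>The pattern written \<open>S\<close> with subscript arrow-\<open>R\<close>: zeros of \<open>S\<close> are filled from \<open>R\<close>, which may itself be zero there.\<close>
definition overlay :: "real mat \<Rightarrow> real mat \<Rightarrow> real mat" where
  "overlay S R = mat (dim_row S) (dim_col S)
     (\<lambda>(i, j). if S $$ (i, j) \<noteq> 0 then S $$ (i, j) else R $$ (i, j))"

definition super_pattern :: "real mat \<Rightarrow> real mat \<Rightarrow> bool" where
  "super_pattern T S \<longleftrightarrow>
     (\<exists>R. R \<in> carrier_mat (dim_row S) (dim_col S) \<and> sign_pattern R \<and> T = overlay S R)"

end

theory Submission imports Defs begin

text \<open>The rows of \<open>Q\<close> are perturbed one after the other, along a parameter \<open>e\<close> tending to \<open>0\<close>
  from the right. Row \<open>m\<close> receives the entries \<open>e * R m j\<close> to the right of the superdiagonal and is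
  then made orthogonal to the already perturbed rows by adding a combination of the \<^emph>\<open>original\<close>
  rows \<open>k < m\<close>. These vanish in all columns \<open>j \<ge> m + 2\<close>, so the prescribed entries survive. The
  coefficients solve a linear system whose matrix tends to the Gram matrix of orthonormal rows,
  i.e. the identity, and whose right-hand side tends to \<open>0\<close>; hence they tend to \<open>0\<close>. Finally,
  normalizing the rows does not change signs.\<close>

text \<open>The proof eliminates the last unknown: the Schur complement again tends to the identity.\<close>
lemma linear_system_near_identity:
  fixes G :: "nat \<Rightarrow> nat \<Rightarrow> 'a \<Rightarrow> real" and b :: "nat \<Rightarrow> 'a \<Rightarrow> real"
  assumes "\<And>i j. i < k \<Longrightarrow> j < k \<Longrightarrow> (G i j \<longlongrightarrow> (if i = j then 1 else 0)) F"
    and "\<And>i. i < k \<Longrightarrow> (b i \<longlongrightarrow> 0) F"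
  shows "\<exists>c. (\<forall>i<k. (c i \<longlongrightarrow> 0) F) \<and>
    (\<forall>\<^sub>F x in F. \<forall>i<k. (\<Sum>j<k. G i j x * c j x) = b i x)"
  using assms
proof (induction k arbitrary: G b)
  case 0
  then show ?case by simp
next
  case (Suc k)
  have Gkk: "(G k k \<longlongrightarrow> 1) F" using Suc.prems(1)[of k k] by simp
  define G' where "G' i j x = G i j x - G i k x * G k j x / G k k x" for i j x
  define b' where "b' i x = b i x - G i k x * b k x / G k k x" for i x
  have G': "(G' i j \<longlongrightarrow> (if i = j then 1 else 0)) F" if "i < k" "j < k" for i j
  proof -
    have "(G' i j \<longlongrightarrow> (if i = j then 1 else 0) - 0 * 0 / 1) F"
      unfolding G'_def using that Suc.prems(1)[of i j] Suc.prems(1)[of i k] Suc.prems(1)[of k j]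
      by (intro tendsto_intros Gkk) auto
    then show ?thesis by simp
  qed
  have b': "(b' i \<longlongrightarrow> 0) F" if "i < k" for i
  proof -
    have "(b' i \<longlongrightarrow> 0 - 0 * 0 / 1) F"
      unfolding b'_def using that Suc.prems(1)[of i k] Suc.prems(2)[of i] Suc.prems(2)[of k]
      by (intro tendsto_intros Gkk) auto
    then show ?thesis by simp
  qed
  obtain c where c: "\<And>i. i < k \<Longrightarrow> (c i \<longlongrightarrow> 0) F"
    and sol: "\<forall>\<^sub>F x in F. \<forall>i<k. (\<Sum>j<k. G' i j x * c j x) = b' i x"
    using Suc.IH[of G' b', OF G' b'] by blast
  \<comment> \<open>Back substitution: \<open>d\<close> is the last unknown, read off from equation
    \<open>k\<close> once the others are known. Where \<open>G k k x = 0\<close> the quotient is the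
    default value 0; this happens at most outside an eventual set, as \<open>G k k\<close> tends to
    1.\<close>
  define d where "d x = (b k x - (\<Sum>j<k. G k j x * c j x)) / G k k x" for x
  have "(G k j \<longlongrightarrow> 0) F" if "j < k" for j using Suc.prems(1)[of k j] that by simp
  then have "(d \<longlongrightarrow> (0 - (\<Sum>j<k. 0 * 0)) / 1) F"
    unfolding d_def using Suc.prems(2)[of k] c
    by (intro tendsto_intros Gkk) auto
  then have d: "(d \<longlongrightarrow> 0) F" by simp
  have "\<forall>\<^sub>F x in F. G k k x \<noteq> 0"
    using tendsto_imp_eventually_ne[OF Gkk, of 0] by simp
  with sol have "\<forall>\<^sub>F x in F. \<forall>i<Suc k. (\<Sum>j<Suc k. G i j x * (c(k := d)) j x) = b i x"
  proof eventually_elim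
    case (elim x)
    have split: "(\<Sum>j<Suc k. G i j x * (c(k := d)) j x) = (\<Sum>j<k. G i j x * c j x) + G i k x * d x"
      for i by simp
    have "(\<Sum>j<Suc k. G i j x * (c(k := d)) j x) = b i x" if i: "i < Suc k" for i
    proof (cases "i = k")
      case True
      then show ?thesis using elim(2) unfolding split by (simp add: d_def)
    next
      case False
      \<comment> \<open>The term \<open>G i k x * d x\<close> gives back what the elimination
        subtracted: the sums over \<open>G k j x * c j x\<close> cancel, and the remaining multiple
        of \<open>b k x\<close> turns \<open>b' i x\<close> into \<open>b i x\<close>.\<close>
      have "(\<Sum>j<k. G' i j x * c j x)
          = (\<Sum>j<k. G i j x * c j x - G i k x / G k k x * (G k j x * c j x))"
        by (intro sum.cong) (auto simp: G'_def algebra_simps)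
      also have "\<dots> = (\<Sum>j<k. G i j x * c j x) - G i k x / G k k x * (\<Sum>j<k. G k j x * c j x)"
        by (simp add: sum_subtractf sum_distrib_left)
      finally have "(\<Sum>j<k. G i j x * c j x)
          = b' i x + G i k x / G k k x * (\<Sum>j<k. G k j x * c j x)"
        using elim(1) i False by simp
      then show ?thesis
        unfolding split by (simp add: b'_def d_def diff_divide_distrib right_diff_distrib)
    qed
    then show ?case by blast
  qed
  moreover have "\<forall>i<Suc k. ((c(k := d)) i \<longlongrightarrow> 0) F" using c d by (simp add: less_Suc_eq)
  ultimately show ?case by blast
qed

text \<open>Induction on the number \<open>m\<close> of rows already perturbed. The limits keep the
  next linear system close to the identity and later preserve the nonzero signs. To the right of the
  superdiagonal a limit 0 would determine no sign, hence the exact formula there. Rows are not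
  normalized, which keeps that formula simple.\<close>

lemma hessenberg_orthogonal_perturbation:
  fixes q R :: "nat \<Rightarrow> nat \<Rightarrow> real"
  assumes orth: "\<And>i l. i < n \<Longrightarrow> l < n \<Longrightarrow> (\<Sum>j<n. q i j * q l j) = (if i = l then 1 else 0)"
    and hess: "\<And>i j. i < n \<Longrightarrow> j < n \<Longrightarrow> i + 2 \<le> j \<Longrightarrow> q i j = 0"
    and "m \<le> n"
  shows "\<exists>r. (\<forall>i<m. \<forall>j<n. (r i j \<longlongrightarrow> q i j) (at_right 0)) \<and>
    (\<forall>\<^sub>F e in at_right 0. \<forall>i<m. \<forall>l<i. (\<Sum>j<n. r i j e * r l j e) = 0) \<and>
    (\<forall>i<m. \<forall>j<n. \<forall>e. i + 2 \<le> j \<longrightarrow> r i j e = e * R i j)"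
  using \<open>m \<le> n\<close>
proof (induction m)
  case 0
  then show ?case by simp
next
  case (Suc m)
  then obtain r where lim: "\<forall>i<m. \<forall>j<n. (r i j \<longlongrightarrow> q i j) (at_right 0)"
    and ort: "\<forall>\<^sub>F e in at_right 0. \<forall>i<m. \<forall>l<i. (\<Sum>j<n. r i j e * r l j e) = 0"
    and pre: "\<forall>i<m. \<forall>j<n. \<forall>e. i + 2 \<le> j \<longrightarrow> r i j e = e * R i j"
    using Suc_leD by blast
  \<comment> \<open>Row \<open>m\<close> before its correction. For \<open>j < n\<close> with
    \<open>m + 2 \<le> j\<close> the summand \<open>q m j\<close> is 0, so the entry there is
    exactly \<open>e * R m j\<close>.\<close>
  define v where "v j e = q m j + (if m + 2 \<le> j then e * R m j else 0)" for j e
  have v: "(v j \<longlongrightarrow> q m j) (at_right 0)" for j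
  proof -
    have "((\<lambda>e. q m j + (if m + 2 \<le> j then e * R m j else 0))
        \<longlongrightarrow> q m j + (if m + 2 \<le> j then 0 * R m j else 0)) (at_right 0)"
      by (cases "m + 2 \<le> j") (auto intro!: tendsto_eq_intros)
    then show ?thesis by (simp add: v_def[abs_def] cong: if_cong)
  qed
  \<comment> \<open>The unknowns multiply the original rows \<open>k\<close>, while orthogonality is
    required against the perturbed rows \<open>l\<close>. So \<open>G\<close> mixes both families
    and becomes the Gram matrix of the rows of \<open>q\<close> only in the limit.\<close>
  define G where "G l k e = (\<Sum>j<n. q k j * r l j e)" for l k e
  define b where "b l e = - (\<Sum>j<n. v j e * r l j e)" for l e
  have "(G l k \<longlongrightarrow> (if l = k then 1 else 0)) (at_right 0)" if "l < m" "k < m" for l k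
  proof -
    have "(G l k \<longlongrightarrow> (\<Sum>j<n. q k j * q l j)) (at_right 0)"
      unfolding G_def using that lim by (intro tendsto_intros) auto
    then show ?thesis using orth[of k l] that Suc.prems by (simp add: eq_commute)
  qed
  moreover have "(b l \<longlongrightarrow> 0) (at_right 0)" if "l < m" for l
  proof -
    have "(b l \<longlongrightarrow> - (\<Sum>j<n. q m j * q l j)) (at_right 0)"
      unfolding b_def using that lim by (intro tendsto_intros v) auto
    then show ?thesis using orth[of m l] that Suc.prems by simp
  qed
  ultimately obtain c where c: "\<And>k. k < m \<Longrightarrow> (c k \<longlongrightarrow> 0) (at_right 0)"
    and sol: "\<forall>\<^sub>F e in at_right 0. \<forall>l<m. (\<Sum>k<m. G l k e * c k e) = b l e"
    using linear_system_near_identity[of m G "at_right 0" b] by blast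
  define s where "s j e = v j e + (\<Sum>k<m. c k e * q k j)" for j e
  have s: "(s j \<longlongrightarrow> q m j) (at_right 0)" for j
  proof -
    have "(s j \<longlongrightarrow> q m j + (\<Sum>k<m. 0 * q k j)) (at_right 0)"
      unfolding s_def using c by (intro tendsto_intros v) auto
    then show ?thesis by simp
  qed
  have s_pre: "s j e = e * R m j" if "j < n" "m + 2 \<le> j" for j e
  proof -
    \<comment> \<open>The case \<open>k < m\<close> removes the correction from column
      \<open>j\<close>, the case \<open>k = m\<close> the unperturbed entry in
      \<open>v\<close>.\<close>
    have "q k j = 0" if "k \<le> m" for k using hess[of k j] that \<open>j < n\<close> \<open>m + 2 \<le> j\<close> by simp
    then show ?thesis using that by (simp add: s_def v_def)
  qed
  let ?r = "r(m := s)"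
  have "\<forall>\<^sub>F e in at_right 0. \<forall>i<Suc m. \<forall>l<i. (\<Sum>j<n. ?r i j e * ?r l j e) = 0"
    using ort sol
  proof eventually_elim
    case (elim e)
    have "(\<Sum>j<n. s j e * r l j e) = 0" if "l < m" for l
    proof -
      have "(\<Sum>j<n. s j e * r l j e)
          = (\<Sum>j<n. v j e * r l j e) + (\<Sum>j<n. \<Sum>k<m. c k e * q k j * r l j e)"
        by (simp add: s_def distrib_right sum.distrib sum_distrib_right)
      \<comment> \<open>After the swap this is the left side of equation \<open>l\<close>, hence
        \<open>b l e\<close>, which cancels the first sum.\<close>
      also have "(\<Sum>j<n. \<Sum>k<m. c k e * q k j * r l j e) = (\<Sum>k<m. G l k e * c k e)"
        by (subst sum.swap) (simp add: G_def sum_distrib_left mult_ac)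
      finally show ?thesis using elim(2) that by (simp add: b_def)
    qed
    then show ?case using elim(1) by (auto simp: less_Suc_eq)
  qed
  moreover have "\<forall>i<Suc m. \<forall>j<n. (?r i j \<longlongrightarrow> q i j) (at_right 0)"
    using lim s by (simp add: less_Suc_eq)
  moreover have "\<forall>i<Suc m. \<forall>j<n. \<forall>e. i + 2 \<le> j \<longrightarrow> ?r i j e = e * R i j"
    using pre s_pre by (simp add: less_Suc_eq)
  ultimately show ?case by blast
qed

lemma eventually_sgn_eq:
  fixes f :: "'a \<Rightarrow> real"
  assumes "(f \<longlongrightarrow> a) F" and "a \<noteq> 0"
  shows "\<forall>\<^sub>F x in F. sgn (f x) = sgn a"
proof (cases "a > 0")
  case True
  then show ?thesis
    using order_tendstoD(1)[OF assms(1), of 0] by (auto elim!: eventually_mono)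
next
  case False
  then show ?thesis
    using order_tendstoD(2)[OF assms(1), of 0] assms(2) by (auto elim!: eventually_mono)
qed

text \<open>Dividing each row by its norm, positive because the row is nonzero, preserves both
  orthogonality and signs.\<close>

lemma allows_orthogonality_of_orthogonal_rows:
  fixes a :: "nat \<Rightarrow> nat \<Rightarrow> real"
  assumes T: "T \<in> carrier_mat n n"
    and orth: "\<And>i l. i < n \<Longrightarrow> l < i \<Longrightarrow> (\<Sum>j<n. a i j * a l j) = 0"
    and nz: "\<And>i. i < n \<Longrightarrow> \<exists>j<n. a i j \<noteq> 0"
    and sgn: "\<And>i j. i < n \<Longrightarrow> j < n \<Longrightarrow> sgn (a i j) = T $$ (i, j)"
  shows "allows_orthogonality T"
proof -
  define N where "N i = sqrt (\<Sum>j<n. a i j * a i j)" for i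
  have N: "N i > 0" if i: "i < n" for i
  proof -
    obtain j where "j < n" "a i j \<noteq> 0" using nz[OF i] by blast
    then have "(\<Sum>j<n. a i j * a i j) > 0"
      by (intro sum_pos2[of _ j]) (auto simp: zero_less_mult_iff)
    then show ?thesis by (simp add: N_def)
  qed
  define P where "P = mat n n (\<lambda>(i, j). a i j / N i)"
  have P: "P \<in> carrier_mat n n" by (simp add: P_def)
  have orth': "(\<Sum>j<n. a i j * a l j) = 0" if "i < n" "l < n" "i \<noteq> l" for i l
    using orth[of i l] orth[of l i] that by (cases "l < i") (auto simp: mult.commute)
  have "P * transpose_mat P = 1\<^sub>m n"
  proof (rule eq_matI)
    fix i l assume "i < dim_row (1\<^sub>m n)" "l < dim_col (1\<^sub>m n)"
    then have il: "i < n" "l < n" by auto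
    have "(P * transpose_mat P) $$ (i, l) = (\<Sum>j<n. a i j / N i * (a l j / N l))"
      using il P by (simp add: scalar_prod_def P_def lessThan_atLeast0)
    also have "\<dots> = (\<Sum>j<n. a i j * a l j) / (N i * N l)"
      by (simp add: sum_divide_distrib)
    also have "\<dots> = 1\<^sub>m n $$ (i, l)"
    proof (cases "i = l")
      case True
      have "(\<Sum>j<n. a i j * a i j) = N i * N i"
        by (simp add: N_def sum_nonneg)
      then show ?thesis using True il N[of i] by simp
    next
      case False
      then show ?thesis using orth'[of i l] il by simp
    qed
    finally show "(P * transpose_mat P) $$ (i, l) = 1\<^sub>m n $$ (i, l)" .
  qed (use P in auto)
  moreover have "sgn_mat P = T"
  proof (rule eq_matI)
    fix i j assume "i < dim_row T" "j < dim_col T"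
    then have "i < n" "j < n" using T by auto
    then show "sgn_mat P $$ (i, j) = T $$ (i, j)"
      using sgn[of i j] N[of i] by (simp add: sgn_mat_def P_def sgn_divide)
  qed (use P T in \<open>auto simp: sgn_mat_def\<close>)
  ultimately show ?thesis
    using P unfolding allows_orthogonality_def orthonormal_mat_def by auto
qed

theorem corollary5p2:
  fixes n :: nat and Q :: "real mat"
  assumes "n \<ge> 2"
    and "Q \<in> carrier_mat n n"
    and "orthonormal_mat Q"
    and "\<And>i j. i < n \<Longrightarrow> j < n \<Longrightarrow> Q $$ (i, j) \<noteq> 0 \<longleftrightarrow> j \<le> i + 1"
  shows "\<forall>T. super_pattern T (sgn_mat Q) \<longrightarrow> allows_orthogonality T"
proof (intro allI impI)
  fix T assume "super_pattern T (sgn_mat Q)"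
  then obtain R where R: "R \<in> carrier_mat n n" "sign_pattern R"
    and T: "T = overlay (sgn_mat Q) R"
    using assms(2) by (auto simp: super_pattern_def sgn_mat_def)
  have T_entry: "T $$ (i, j) = (if Q $$ (i, j) \<noteq> 0 then sgn (Q $$ (i, j)) else R $$ (i, j))"
    if "i < n" "j < n" for i j
    using that assms(2) by (simp add: T overlay_def sgn_mat_def sgn_zero_iff)
  \<comment> \<open>The values 0, 1, -1 are fixed by \<open>sgn\<close>, so for \<open>e > 0\<close>
    the entry \<open>e * R $$ (i, j)\<close> has the prescribed sign, including an exact 0.\<close>
  have sgn_R: "sgn (R $$ (i, j)) = R $$ (i, j)" if "i < n" "j < n" for i j
  proof -
    have "R $$ (i, j) \<in> elements_mat R" using that R(1) by auto
    then show ?thesis using R(2) by (auto simp: sign_pattern_def)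
  qed
  have orth: "(\<Sum>j<n. Q $$ (i, j) * Q $$ (l, j)) = (if i = l then 1 else 0)"
    if "i < n" "l < n" for i l
  proof -
    have "(Q * transpose_mat Q) $$ (i, l) = 1\<^sub>m n $$ (i, l)"
      using assms(2,3) by (simp add: orthonormal_mat_def)
    then show ?thesis
      using that assms(2) by (simp add: scalar_prod_def lessThan_atLeast0)
  qed
  have hess: "Q $$ (i, j) = 0" if "i < n" "j < n" "i + 2 \<le> j" for i j
    using assms(4)[of i j] that by auto
  have "\<exists>r. (\<forall>i<n. \<forall>j<n. (r i j \<longlongrightarrow> Q $$ (i, j)) (at_right 0)) \<and>
      (\<forall>\<^sub>F e in at_right 0. \<forall>i<n. \<forall>l<i. (\<Sum>j<n. r i j e * r l j e) = 0) \<and>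
      (\<forall>i<n. \<forall>j<n. \<forall>e. i + 2 \<le> j \<longrightarrow> r i j e = e * R $$ (i, j))"
    by (rule hessenberg_orthogonal_perturbation) (simp_all add: orth hess)
  then obtain r where
    lim: "\<forall>i<n. \<forall>j<n. (r i j \<longlongrightarrow> Q $$ (i, j)) (at_right 0)"
    and ort: "\<forall>\<^sub>F e in at_right 0. \<forall>i<n. \<forall>l<i. (\<Sum>j<n. r i j e * r l j e) = 0"
    and pre: "\<forall>i<n. \<forall>j<n. \<forall>e. i + 2 \<le> j \<longrightarrow> r i j e = e * R $$ (i, j)"
    by (elim exE conjE)
  have "\<forall>\<^sub>F e in at_right 0. sgn (r i j e) = T $$ (i, j)" if ij: "i < n" "j < n" for i j
  proof (cases "Q $$ (i, j) = 0")
    case False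
    then show ?thesis using eventually_sgn_eq[of "r i j" "Q $$ (i, j)"] lim ij T_entry[OF ij] by simp
  next
    case True
    then have "i + 2 \<le> j" using assms(4)[OF ij] by auto
    then have "r i j e = e * R $$ (i, j)" for e using pre ij by blast
    moreover have "\<forall>\<^sub>F e in at_right (0::real). sgn e = 1"
      using eventually_at_right_less[of "0::real"] by (rule eventually_mono) simp
    ultimately show ?thesis
      using True T_entry[OF ij] sgn_R[OF ij] by (auto elim!: eventually_mono simp: sgn_mult)
  qed
  \<comment> \<open>Finitely many positions, so one neighbourhood serves all; rewriting the bounds
    as finite sets makes this applicable.\<close>
  then have "\<forall>\<^sub>F e in at_right 0. \<forall>i\<in>{..<n}. \<forall>j\<in>{..<n}. sgn (r i j e) = T $$ (i, j)"
    by (intro eventually_ball_finite ballI) auto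
  with ort have "\<forall>\<^sub>F e in at_right 0. (\<forall>i<n. \<forall>l<i. (\<Sum>j<n. r i j e * r l j e) = 0) \<and>
      (\<forall>i<n. \<forall>j<n. sgn (r i j e) = T $$ (i, j))"
    by eventually_elim auto
  then have "\<exists>e. (\<forall>i<n. \<forall>l<i. (\<Sum>j<n. r i j e * r l j e) = 0) \<and>
      (\<forall>i<n. \<forall>j<n. sgn (r i j e) = T $$ (i, j))"
    by (rule eventually_happens'[OF trivial_limit_at_right_real])
  then obtain e where e: "\<forall>i<n. \<forall>l<i. (\<Sum>j<n. r i j e * r l j e) = 0"
      "\<forall>i<n. \<forall>j<n. sgn (r i j e) = T $$ (i, j)"
    by (elim exE conjE)
  show "allows_orthogonality T"
  proof (rule allows_orthogonality_of_orthogonal_rows[where a = "\<lambda>i j. r i j e"])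
    show "T \<in> carrier_mat n n" using assms(2) by (simp add: T overlay_def sgn_mat_def)
    fix i assume i: "i < n"
    \<comment> \<open>The diagonal satisfies \<open>j \<le> i + 1\<close>, so its nonzero sign shows
      that no row vanishes at the chosen \<open>e\<close>.\<close>
    have "Q $$ (i, i) \<noteq> 0" using assms(4)[OF i i] by simp
    then have "r i i e \<noteq> 0" using e(2) i T_entry[OF i i] by (metis sgn_zero_iff)
    then show "\<exists>j<n. r i j e \<noteq> 0" using i by blast
  qed (use e in auto)
qed

end
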